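(* Let $f:A\to B$ be a ring homomorphism and let $J$ be an ideal of $B$. If $\pi:B\to B/J$ is the canonical projection and $\breve f:=\pi\circ f:A\to B/J$, then $A\Join^f J=\breve f\times_{B/J}\pi$ (as subrings of $A\times B$).
   Context: All rings are commutative with identity and ring homomorphisms preserve the identity. For a ring homomorphism $f:A\to B$ and an ideal $J$ of $B$, the amalgamation of $A$ with $B$ along $J$ with respect to $f$ is the subring $A\Join^f J:=\{(a,f(a)+j)\mid a\in A,\ j\in J\}$ of $A\times B$. For ring homomorphisms $\alpha:A\to C$ and $\beta:B\to C$, the pullback (or fiber product) of $\alpha$ and $\beta$ is the subring $\alpha\times_C\beta:=\{(a,b)\in A\times B\mid \alpha(a)=\beta(b)\}$ of $A\times B$. *)

theory Defs
  imports "HOL-Algebra.Chinese_Remainder" "HOL-Algebra.Subrings"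
begin

definition amalgamation ::
  "('a, 'm) ring_scheme \<Rightarrow> ('b, 'n) ring_scheme \<Rightarrow> ('a \<Rightarrow> 'b) \<Rightarrow> 'b set \<Rightarrow> ('a \<times> 'b) set"
  where "amalgamation A B f J = {(a, f a \<oplus>\<^bsub>B\<^esub> j) | a j. a \<in> carrier A \<and> j \<in> J}"

(* The common codomain C of alpha and beta enters only through the equation alpha a = beta b,
   so it is not a parameter; it reappears in subring_pullback. *)
definition pullback ::
  "('a, 'm) ring_scheme \<Rightarrow> ('b, 'n) ring_scheme \<Rightarrow> ('a \<Rightarrow> 'c) \<Rightarrow> ('b \<Rightarrow> 'c) \<Rightarrow> ('a \<times> 'b) set"
  where "pullback A B \<alpha> \<beta> = {(a, b) \<in> carrier A \<times> carrier B. \<alpha> a = \<beta> b}"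

(* The two sets are subrings of the product ring, so equality of the sets is equality of
   subrings. *)

lemma RDirProd_simps:
  "carrier (RDirProd A B) = carrier A \<times> carrier B"
  "\<one>\<^bsub>RDirProd A B\<^esub> = (\<one>\<^bsub>A\<^esub>, \<one>\<^bsub>B\<^esub>)"
  "\<zero>\<^bsub>RDirProd A B\<^esub> = (\<zero>\<^bsub>A\<^esub>, \<zero>\<^bsub>B\<^esub>)"
  "(a, b) \<otimes>\<^bsub>RDirProd A B\<^esub> (a', b') = (a \<otimes>\<^bsub>A\<^esub> a', b \<otimes>\<^bsub>B\<^esub> b')"
  "(a, b) \<oplus>\<^bsub>RDirProd A B\<^esub> (a', b') = (a \<oplus>\<^bsub>A\<^esub> a', b \<oplus>\<^bsub>B\<^esub> b')"
  by (auto simp: RDirProd_def DirProd_def monoid.defs)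

lemma RDirProd_a_inv:
  assumes "ring A" "ring B" "a \<in> carrier A" "b \<in> carrier B"
  shows "\<ominus>\<^bsub>RDirProd A B\<^esub> (a, b) = (\<ominus>\<^bsub>A\<^esub> a, \<ominus>\<^bsub>B\<^esub> b)"
proof -
  interpret A: ring A by fact
  interpret B: ring B by fact
  interpret P: ring "RDirProd A B" by (rule RDirProd_ring[OF assms(1,2)])
  show ?thesis
    by (rule P.minus_equality) (use assms in \<open>auto simp: RDirProd_simps A.l_neg B.l_neg\<close>)
qed

lemma subring_pullback:
  assumes \<alpha>: "ring_hom_cring A C \<alpha>" and \<beta>: "ring_hom_cring B C \<beta>"
  shows "subring (pullback A B \<alpha> \<beta>) (RDirProd A B)"
proof -
  interpret a: ring_hom_cring A C \<alpha> by fact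
  interpret b: ring_hom_cring B C \<beta> by fact
  interpret P: ring "RDirProd A B" by (rule RDirProd_ring) unfold_locales
  show ?thesis
    by (rule P.subringI)
      (auto simp: pullback_def RDirProd_simps RDirProd_a_inv a.R.ring_axioms b.R.ring_axioms)
qed

lemma subring_amalgamation:
  assumes f: "ring_hom_cring A B f" and J: "ideal J B"
  shows "subring (amalgamation A B f J) (RDirProd A B)"
proof -
  interpret f: ring_hom_cring A B f by fact
  interpret J: ideal J B by fact
  interpret P: ring "RDirProd A B" by (rule RDirProd_ring) unfold_locales
  have memI: "(a, b) \<in> amalgamation A B f J"
    if "a \<in> carrier A" "j \<in> J" "b = f a \<oplus>\<^bsub>B\<^esub> j" for a b j
    using that by (auto simp: amalgamation_def)
  show ?thesis
  proof (rule P.subringI)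
    show "amalgamation A B f J \<subseteq> carrier (RDirProd A B)"
      by (auto simp: amalgamation_def RDirProd_simps J.Icarr)
    show "\<one>\<^bsub>RDirProd A B\<^esub> \<in> amalgamation A B f J"
      unfolding RDirProd_simps by (rule memI[where j = "\<zero>\<^bsub>B\<^esub>"]) auto
  next
    fix h assume "h \<in> amalgamation A B f J"
    then obtain a j where h: "h = (a, f a \<oplus>\<^bsub>B\<^esub> j)" "a \<in> carrier A" "j \<in> J"
      by (auto simp: amalgamation_def)
    then show "\<ominus>\<^bsub>RDirProd A B\<^esub> h \<in> amalgamation A B f J"
      by (auto simp: RDirProd_a_inv f.R.ring_axioms f.S.ring_axioms J.Icarr f.S.minus_add
          intro!: memI[where j = "\<ominus>\<^bsub>B\<^esub> j"])
  next
    fix h h' assume "h \<in> amalgamation A B f J" "h' \<in> amalgamation A B f J"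
    then obtain a j a' j' where h: "h = (a, f a \<oplus>\<^bsub>B\<^esub> j)" "a \<in> carrier A" "j \<in> J"
      "h' = (a', f a' \<oplus>\<^bsub>B\<^esub> j')" "a' \<in> carrier A" "j' \<in> J"
      by (auto simp: amalgamation_def)
    have [simp]: "j \<in> carrier B" "j' \<in> carrier B" using h J.Icarr by auto
    show "h \<oplus>\<^bsub>RDirProd A B\<^esub> h' \<in> amalgamation A B f J"
      unfolding h RDirProd_simps
      by (rule memI[where j = "j \<oplus>\<^bsub>B\<^esub> j'"]) (use h in \<open>auto simp: f.S.a_ac\<close>)
    show "h \<otimes>\<^bsub>RDirProd A B\<^esub> h' \<in> amalgamation A B f J"
      unfolding h RDirProd_simps
      by (rule memI[where j = "f a \<otimes>\<^bsub>B\<^esub> j' \<oplus>\<^bsub>B\<^esub> (j \<otimes>\<^bsub>B\<^esub> f a' \<oplus>\<^bsub>B\<^esub> j \<otimes>\<^bsub>B\<^esub> j')"])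
        (use h in \<open>auto simp: f.S.l_distr f.S.r_distr f.S.a_ac J.I_l_closed J.I_r_closed\<close>)
  qed
qed

end

theory Submission
  imports Defs
begin

text \<open>Both sets are compared fibre by fibre over \<open>a\<close> in \<open>A\<close>. The
  fibre of the amalgamation is the coset of \<open>J\<close> through \<open>f a\<close>; that of the
  pullback is the set of \<open>b\<close> with the same class as \<open>f a\<close> in B/J. Two
  elements have the same class exactly when their difference lies in \<open>J\<close>
  (\<open>quotient_eq_iff_same_a_r_cos\<close>), so the fibres agree.\<close>

theorem proposition4p2:
  fixes A :: "('a, 'm) ring_scheme" and B :: "('b, 'n) ring_scheme"
    and f :: "'a \<Rightarrow> 'b" and J :: "'b set"
  assumes "cring A" and "cring B"
    and "f \<in> ring_hom A B"
    and "ideal J B"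
  shows "amalgamation A B f J = pullback A B ((+>\<^bsub>B\<^esub>) J \<circ> f) ((+>\<^bsub>B\<^esub>) J)"
proof -
  interpret J: ideal J B by fact
  \<comment> \<open>Equality of the fibres over \<open>a\<close>; the carrier condition on the right
    is the one built into \<open>pullback\<close>.\<close>
  have "(\<exists>j\<in>J. b = f a \<oplus>\<^bsub>B\<^esub> j) \<longleftrightarrow> b \<in> carrier B \<and> J +>\<^bsub>B\<^esub> f a = J +>\<^bsub>B\<^esub> b"
    if "a \<in> carrier A" for a b
  proof -
    have fa: "f a \<in> carrier B"
      using that assms(3) by (rule ring_hom_closed[rotated])
    \<comment> \<open>The difference is taken as b - f(a) so that it is itself the \<open>j\<close>
      to be added to \<open>f a\<close>.\<close>
    have coset: "J +>\<^bsub>B\<^esub> f a = J +>\<^bsub>B\<^esub> b \<longleftrightarrow> b \<ominus>\<^bsub>B\<^esub> f a \<in> J" if "b \<in> carrier B"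
      using J.quotient_eq_iff_same_a_r_cos[OF assms(4) that fa] by auto
    show ?thesis
    proof
      assume "\<exists>j\<in>J. b = f a \<oplus>\<^bsub>B\<^esub> j"
      then obtain j where j: "j \<in> J" "b = f a \<oplus>\<^bsub>B\<^esub> j" by blast
      then have "b \<in> carrier B" "b \<ominus>\<^bsub>B\<^esub> f a = j"
        using fa J.Icarr by (auto simp: J.minus_eq J.a_ac J.r_neg J.r_neg1 J.r_neg2)
      then show "b \<in> carrier B \<and> J +>\<^bsub>B\<^esub> f a = J +>\<^bsub>B\<^esub> b"
        using coset j(1) by simp
    next
      assume b: "b \<in> carrier B \<and> J +>\<^bsub>B\<^esub> f a = J +>\<^bsub>B\<^esub> b"
      \<comment> \<open>This exhibits b - f(a) as the witness; \<open>coset\<close> places it in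
        \<open>J\<close>.\<close>
      then have "b = f a \<oplus>\<^bsub>B\<^esub> (b \<ominus>\<^bsub>B\<^esub> f a)"
        using fa by (simp add: J.minus_eq J.a_lcomm J.r_neg)
      then show "\<exists>j\<in>J. b = f a \<oplus>\<^bsub>B\<^esub> j"
        using b coset by blast
    qed
  qed
  then show ?thesis
    unfolding amalgamation_def pullback_def by fastforce
qed

end
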